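(* Let $n,g>0$ be integers such that $2g\leq n$, and let $p$ be an integer. Let $\beta=h_S-2g\,r_n$ be a curve class on a Hilbert scheme $S^{[n]}$ of a $K3$ surface $S$, with $h_S^2=2p-2$. Then the condition $p\geq g$ is equivalent to the existence of integers $d_1,\dots,d_{n-1}$ and $r_1,\dots,r_{n-1}$ such that $$q(\beta)=-2+\sum_{i=1}^{n-1}2d_i-\frac1{2n-2}\Big(\sum_{i=1}^{n-1}r_i\Big)^2,\qquad [\beta]=\pm\Big[\sum_{i=1}^{n-1}r_i\Big],\qquad 4d_i-r_i^2\geq0\ \text{ for all } i .$$
   Context: $S^{[n]}$ is the Hilbert scheme of length-$n$ subschemes of a complex $K3$ surface $S$ and $q$ is the Beauville-Bogomolov form on $H^2(S^{[n]},\mathbb Z)$. Each $Z\in H_2(S^{[n]},\mathbb Z)$ is identified with the unique $D_Z\in H^2(S^{[n]},\mathbb Q)$ with $q(D_Z,D')=Z\cdot D'$ for all $D'$, so $H_2(S^{[n]},\mathbb Z)\cong H^2(S^{[n]},\mathbb Z)^\vee$ carries a $\mathbb Q$-valued form $q$. There is an orthogonal decomposition $H_2(S^{[n]},\mathbb Z)=H_2(S,\mathbb Z)\oplus\mathbb Z r_n$, where $H_2(S,\mathbb Z)$ carries the intersection form, $r_n$ is the class of the general positive-dimensional fibre of the Hilbert-Chow morphism $S^{[n]}\to S^{(n)}$, and $q(r_n)=-\frac1{2n-2}$; a class $h_S\in H^2(S,\mathbb Z)\cong H_2(S,\mathbb Z)$ is regarded as a class in $H_2(S^{[n]},\mathbb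 Z)$. $[\beta]$ is the class of $\beta$ in the discriminant group $H^2(S^{[n]},\mathbb Z)^\vee/H^2(S^{[n]},\mathbb Z)\cong\mathbb Z/(2n-2)\mathbb Z$, which is generated by the class of $r_n$; for an integer $r$, $[r]$ denotes $r$ times this generator. *)

theory Defs
  imports "HOL-Analysis.Finite_Cartesian_Product" "HOL-Library.Numeral_Type" "HOL-Algebra.Elementary_Groups"
begin

definition U_form :: "int^2 \<Rightarrow> int^2 \<Rightarrow> int" where
  "U_form x y = x$1 * y$2 + x$2 * y$1"

text \<open>The nodes of the Dynkin diagram are the elements \<open>1, \<dots>, 8\<close> of the index type
  (where \<open>8 = 0\<close>); the branch node is \<open>5\<close>, with arms of lengths 1, 2 and 4.\<close>

definition E8_edges :: "(8 \<times> 8) set" where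
  "E8_edges = {(1,2), (2,3), (3,4), (4,5), (5,6), (6,7), (5,8)}"

definition E8_form :: "int^8 \<Rightarrow> int^8 \<Rightarrow> int" where
  "E8_form x y = 2 * (\<Sum>i\<in>UNIV. x$i * y$i) - (\<Sum>(i,j)\<in>E8_edges. x$i * y$j + x$j * y$i)"

text \<open>The K3 lattice: three copies of the hyperbolic plane and two copies of the negative
  definite \<open>E8\<close>.\<close>

type_synonym K3_lattice = "((int^2)^3) \<times> ((int^8)^2)"

definition K3_form :: "K3_lattice \<Rightarrow> K3_lattice \<Rightarrow> int" where
  "K3_form x y = (\<Sum>i\<in>UNIV. U_form (fst x $ i) (fst y $ i))
               - (\<Sum>i\<in>UNIV. E8_form (snd x $ i) (snd y $ i))"

definition is_K3_lattice :: "'a monoid \<Rightarrow> ('a \<Rightarrow> 'a \<Rightarrow> int) \<Rightarrow> bool" where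
  "is_K3_lattice L b \<longleftrightarrow> comm_group L \<and>
     (\<exists>f :: 'a \<Rightarrow> K3_lattice. bij_betw f (carrier L) UNIV \<and>
        (\<forall>x\<in>carrier L. \<forall>y\<in>carrier L. f (x \<otimes>\<^bsub>L\<^esub> y) = f x + f y) \<and>
        (\<forall>x\<in>carrier L. \<forall>y\<in>carrier L. K3_form (f x) (f y) = b x y))"

definition bilinear_pairing ::
    "'a monoid \<Rightarrow> 'b monoid \<Rightarrow> ('a \<Rightarrow> 'b \<Rightarrow> int) \<Rightarrow> bool" where
  "bilinear_pairing A B b \<longleftrightarrow>
     (\<forall>x\<in>carrier A. b x \<in> hom B integer_group) \<and>
     (\<forall>y\<in>carrier B. (\<lambda>x. b x y) \<in> hom A integer_group)"

definition perfect_pairing ::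
    "'a monoid \<Rightarrow> 'b monoid \<Rightarrow> ('a \<Rightarrow> 'b \<Rightarrow> int) \<Rightarrow> bool" where
  "perfect_pairing A B b \<longleftrightarrow> bilinear_pairing A B b \<and>
     (\<forall>\<phi>\<in>hom B integer_group. \<exists>!x. x \<in> carrier A \<and> (\<forall>y\<in>carrier B. b x y = \<phi> y)) \<and>
     (\<forall>\<phi>\<in>hom A integer_group. \<exists>!y. y \<in> carrier B \<and> (\<forall>x\<in>carrier A. b x y = \<phi> x))"

text \<open>The homological data of a Hilbert scheme \<open>S\<^sup>[\<^sup>n\<^sup>]\<close> of points on a K3 surface \<open>S\<close>.
  The groups are written multiplicatively, as in the library's homology groups.
  \<^item> \<open>surface_hom\<close>, \<open>surface_form\<close>: the group \<open>H\<^sub>2(S,\<int>)\<close>, identified with \<open>H\<^sup>2(S,\<int>)\<close> by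
    Poincare duality, and its intersection form;
  \<^item> \<open>coh\<close>, \<open>bb_form\<close>: the group \<open>H\<^sup>2(S\<^sup>[\<^sup>n\<^sup>],\<int>)\<close> and its Beauville-Bogomolov form;
  \<^item> \<open>hom2\<close>, \<open>pairing\<close>: the group \<open>H\<^sub>2(S\<^sup>[\<^sup>n\<^sup>],\<int>)\<close> and its pairing with \<open>H\<^sup>2(S\<^sup>[\<^sup>n\<^sup>],\<int>)\<close>;
  \<^item> \<open>incl\<close>: the inclusion of \<open>H\<^sub>2(S,\<int>)\<close> in \<open>H\<^sub>2(S\<^sup>[\<^sup>n\<^sup>],\<int>)\<close>;
  \<^item> \<open>fibre\<close>: the class \<open>r\<^sub>n\<close> of the general positive-dimensional Hilbert-Chow fibre.\<close>

record ('a, 'b, 'c) hilb_data =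
  surface_hom :: "'a monoid"
  surface_form :: "'a \<Rightarrow> 'a \<Rightarrow> int"
  coh :: "'b monoid"
  bb_form :: "'b \<Rightarrow> 'b \<Rightarrow> int"
  hom2 :: "'c monoid"
  pairing :: "'c \<Rightarrow> 'b \<Rightarrow> int"
  incl :: "'a \<Rightarrow> 'c"
  fibre :: "'c"

text \<open>\<open>rat_dual H Z D N\<close> says that the rational class \<open>D\<^sub>Z\<close> with \<open>q(D\<^sub>Z, D') = Z \<cdot> D'\<close> for all
  \<open>D'\<close> is \<open>D / N\<close>, where \<open>D\<close> is integral and \<open>N > 0\<close>.\<close>

definition rat_dual ::
    "('a, 'b, 'c) hilb_data \<Rightarrow> 'c \<Rightarrow> 'b \<Rightarrow> int \<Rightarrow> bool" where
  "rat_dual H Z D N \<longleftrightarrow> D \<in> carrier (coh H) \<and> 0 < N \<and>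
     (\<forall>D'\<in>carrier (coh H). bb_form H D D' = N * pairing H Z D')"

text \<open>The rational form \<open>q(Z, Z') = q(D\<^sub>Z, D\<^sub>Z')\<close> on \<open>H\<^sub>2(S\<^sup>[\<^sup>n\<^sup>],\<int>)\<close>.\<close>

definition q_form :: "('a, 'b, 'c) hilb_data \<Rightarrow> 'c \<Rightarrow> 'c \<Rightarrow> rat" where
  "q_form H Z Z' = (THE t. \<exists>D N D' N'. rat_dual H Z D N \<and> rat_dual H Z' D' N' \<and>
     t = of_int (bb_form H D D') / of_int (N * N'))"

text \<open>\<open>H\<^sup>2(S\<^sup>[\<^sup>n\<^sup>],\<int>)\<close> as a subgroup of its dual \<open>H\<^sub>2(S\<^sup>[\<^sup>n\<^sup>],\<int>)\<close>, via \<open>D \<mapsto> q(D, -)\<close>.\<close>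

definition coh_in_hom2 :: "('a, 'b, 'c) hilb_data \<Rightarrow> 'c set" where
  "coh_in_hom2 H = {Z \<in> carrier (hom2 H). \<exists>D\<in>carrier (coh H).
     \<forall>D'\<in>carrier (coh H). pairing H Z D' = bb_form H D D'}"

definition disc_group :: "('a, 'b, 'c) hilb_data \<Rightarrow> 'c set monoid" where
  "disc_group H = hom2 H Mod coh_in_hom2 H"

definition disc_class :: "('a, 'b, 'c) hilb_data \<Rightarrow> 'c \<Rightarrow> 'c set" where
  "disc_class H Z = coh_in_hom2 H #>\<^bsub>hom2 H\<^esub> Z"

definition disc_of_int :: "('a, 'b, 'c) hilb_data \<Rightarrow> int \<Rightarrow> 'c set" where
  "disc_of_int H k = disc_class H (fibre H) [^]\<^bsub>disc_group H\<^esub> k"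

text \<open>The assumption \<open>rat_dual_exists\<close> together with \<open>bb_nondegenerate\<close> says that the
  Beauville-Bogomolov form is nondegenerate over the rationals; this makes the definition of
  \<open>q_form\<close> meaningful.\<close>

locale hilb_K3 =
  fixes n :: nat and H :: "('a, 'b, 'c) hilb_data"
  assumes surface_K3: "is_K3_lattice (surface_hom H) (surface_form H)"
    and coh_group: "comm_group (coh H)"
    and hom2_group: "comm_group (hom2 H)"
    and pairing_perfect: "perfect_pairing (hom2 H) (coh H) (pairing H)"
    and bb_bilinear: "bilinear_pairing (coh H) (coh H) (bb_form H)"
    and bb_symmetric: "\<And>D D'. D \<in> carrier (coh H) \<Longrightarrow> D' \<in> carrier (coh H) \<Longrightarrow>
          bb_form H D D' = bb_form H D' D"
    and bb_nondegenerate: "\<And>D. D \<in> carrier (coh H) \<Longrightarrow>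
          (\<forall>D'\<in>carrier (coh H). bb_form H D D' = 0) \<Longrightarrow> D = \<one>\<^bsub>coh H\<^esub>"
    and rat_dual_exists: "\<And>Z. Z \<in> carrier (hom2 H) \<Longrightarrow> \<exists>D N. rat_dual H Z D N"
    and decomposition: "(\<lambda>(h, k). incl H h \<otimes>\<^bsub>hom2 H\<^esub> fibre H [^]\<^bsub>hom2 H\<^esub> k)
          \<in> iso (surface_hom H \<times>\<times> integer_group) (hom2 H)"
    and incl_closed: "incl H \<in> hom (surface_hom H) (hom2 H)"
    and fibre_closed: "fibre H \<in> carrier (hom2 H)"
    and q_surface: "\<And>h h'. h \<in> carrier (surface_hom H) \<Longrightarrow> h' \<in> carrier (surface_hom H) \<Longrightarrow>
          q_form H (incl H h) (incl H h') = of_int (surface_form H h h')"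
    and q_orthogonal: "\<And>h. h \<in> carrier (surface_hom H) \<Longrightarrow>
          q_form H (incl H h) (fibre H) = 0"
    and q_fibre: "q_form H (fibre H) (fibre H) = - 1 / (2 * of_nat n - 2)"

end

theory Submission imports Defs begin

text \<open>Put \<open>m = n - 1\<close>. The rational form makes \<open>H\<^sup>2(S\<^sup>[\<^sup>n\<^sup>],\<int>)\<close> the dual lattice of \<open>H\<^sub>2(S\<^sup>[\<^sup>n\<^sup>],\<int>)\<close>,
  so it contains \<open>H\<^sub>2(S,\<int>)\<close>, and \<open>k r\<^sub>n\<close> lies in it only if \<open>2m\<close> divides \<open>k\<close>. With \<open>s = \<Sum>r\<^sub>i\<close>
  the condition therefore reads: \<open>s = \<plusminus>2g + 2mt\<close> for some integer \<open>t\<close>, and \<open>4m (p - \<Sum>d\<^sub>i) = 4g\<^sup>2 - s\<^sup>2\<close>.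
  The condition is invariant under \<open>(r\<^sub>i, d\<^sub>i) \<mapsto> (r\<^sub>i - 2t, d\<^sub>i - r\<^sub>i t + t\<^sup>2)\<close>, which preserves
  \<open>4d\<^sub>i - r\<^sub>i\<^sup>2\<close>, so one may assume \<open>t = 0\<close>. Then \<open>p = \<Sum>d\<^sub>i\<close>, and \<open>4d \<ge> r\<^sup>2\<close> forces \<open>2d \<ge> \<bar>r\<bar>\<close> for
  integers, whence \<open>p \<ge> g\<close>. Conversely \<open>g\<close> pairs \<open>(d\<^sub>i, r\<^sub>i) = (1, 2)\<close>, padded with zeros, have
  \<open>\<Sum>d\<^sub>i = g\<close>, and enlarging \<open>d\<^sub>1\<close> gives every \<open>p \<ge> g\<close>.\<close>

section \<open>Integer inequalities\<close>

lemma abs_le_double_if_square_le: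
  fixes d r :: int
  assumes "r\<^sup>2 \<le> 4 * d"
  shows "\<bar>r\<bar> \<le> 2 * d"
proof (rule ccontr)
  assume "\<not> \<bar>r\<bar> \<le> 2 * d"
  \<comment> \<open>Integrality enters here: \<open>\<bar>r\<bar>\<close> is at least
    \<open>2 * d + 1\<close>. The claim fails for real numbers, for example at r = 1, d =
    1/4.\<close>
  then have "4 * d \<le> 2 * \<bar>r\<bar> - 2" by linarith
  moreover have "0 \<le> (\<bar>r\<bar> - 1)\<^sup>2" by simp
  then have "2 * \<bar>r\<bar> - 1 \<le> r\<^sup>2" by (simp add: power2_diff)
  ultimately show False using assms by linarith
qed

text \<open>Here \<open>u\<close> stands for 2g or -2g, and \<open>t\<close> measures how far the
  sum of the \<open>r i\<close> is from it modulo \<open>2 * card I\<close>. Shifting each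
  \<open>r i\<close> by \<open>2 * t\<close> makes the sum exactly \<open>u\<close>, after which the
  triangle inequality suffices.\<close>

lemma le_if_square_bounds:
  fixes g p t u :: int and d r :: "nat \<Rightarrow> int"
  assumes m: "card I > 0"
    and bound: "\<And>i. i \<in> I \<Longrightarrow> (r i)\<^sup>2 \<le> 4 * d i"
    and u: "\<bar>u\<bar> = 2 * g"
    and sum_r: "(\<Sum>i\<in>I. r i) = u + 2 * int (card I) * t"
    and sum_d: "4 * int (card I) * (p - (\<Sum>i\<in>I. d i)) = 4 * g\<^sup>2 - (\<Sum>i\<in>I. r i)\<^sup>2"
  shows "g \<le> p"
proof -
  let ?m = "int (card I)"
  define r' where "r' i = r i - 2 * t" for i
  define d' where "d' i = d i - r i * t + t\<^sup>2" for i
  have sum_r': "(\<Sum>i\<in>I. r' i) = u"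
    by (simp add: r'_def sum_subtractf sum_r)
  have sum_d': "(\<Sum>i\<in>I. d' i) = (\<Sum>i\<in>I. d i) - (\<Sum>i\<in>I. r i) * t + ?m * t\<^sup>2"
    by (simp add: d'_def sum.distrib sum_subtractf sum_distrib_right)
  have "u\<^sup>2 = 4 * g\<^sup>2"
    using arg_cong[OF u, of "\<lambda>x. x\<^sup>2"] by (simp add: power_mult_distrib)
  \<comment> \<open>With m the cardinality, u^2 - (u + 2mt)^2 = 4m (m t^2 - (u + 2mt) t), so the
    factor 4m cancels.\<close>
  then have "4 * ?m * (p - (\<Sum>i\<in>I. d i)) = 4 * ?m * (?m * t\<^sup>2 - (\<Sum>i\<in>I. r i) * t)"
    unfolding sum_d by (simp add: sum_r power2_eq_square algebra_simps)
  then have "p = (\<Sum>i\<in>I. d' i)"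
    using m by (simp add: sum_d')
  moreover have "\<bar>r' i\<bar> \<le> 2 * d' i" if "i \<in> I" for i
    using bound[OF that]
    by (intro abs_le_double_if_square_le) (simp add: r'_def d'_def power2_eq_square algebra_simps)
  then have "\<bar>\<Sum>i\<in>I. r' i\<bar> \<le> (\<Sum>i\<in>I. 2 * d' i)"
    by (rule order_trans[OF sum_abs sum_mono])
  ultimately show ?thesis
    using u sum_r' by (simp add: sum_distrib_left[symmetric])
qed

lemma ex_square_bounds:
  fixes g m :: nat and p :: int
  assumes "0 < g" "g \<le> m" "int g \<le> p"
  obtains d r :: "nat \<Rightarrow> int" where "(\<Sum>i=1..m. d i) = p" "(\<Sum>i=1..m. r i) = 2 * int g"
    "\<And>i. i \<in> {1..m} \<Longrightarrow> (r i)\<^sup>2 \<le> 4 * d i"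
proof
  let ?r = "\<lambda>i. if i \<in> {1..g} then 2 else 0 :: int"
  \<comment> \<open>The excess p - g is put on index 1, which lies in \<open>{1..g}\<close> and
    \<open>{1..m}\<close> because 0 < g and g \<le> m.\<close>
  let ?d = "\<lambda>i. (if i \<in> {1..g} then 1 else 0) + (if i = 1 then p - int g else 0)"
  have inter: "{1..m} \<inter> {1..g} = {1..g}"
    using assms(2) by (simp add: min_absorb2)
  show "(\<Sum>i=1..m. ?r i) = 2 * int g"
    by (subst sum.inter_restrict[symmetric], simp, subst inter, simp)
  have "(\<Sum>i=1..m. if i \<in> {1..g} then 1 else 0) = int g"
    by (subst sum.inter_restrict[symmetric], simp, subst inter, simp)
  then show "(\<Sum>i=1..m. ?d i) = p"
    using assms by (subst sum.distrib) simp
  show "(?r i)\<^sup>2 \<le> 4 * ?d i" if "i \<in> {1..m}" for i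
    using assms by auto
qed

lemma hom_integer_group_int_pow:
  assumes "group G" "f \<in> hom G integer_group" "x \<in> carrier G"
  shows "f (x [^]\<^bsub>G\<^esub> (k :: int)) = k * f x"
  using hom_int_pow[OF assms(2,3,1) group_integer_group, of k] by simp

section \<open>The rational form on H_2\<close>

context hilb_K3
begin

sublocale hom2: comm_group "hom2 H"
  by (rule hom2_group)

lemma incl_carrier [simp]: "h \<in> carrier (surface_hom H) \<Longrightarrow> incl H h \<in> carrier (hom2 H)"
  using incl_closed by (auto simp: hom_def)

lemma pairing_bilinear: "bilinear_pairing (hom2 H) (coh H) (pairing H)"
  using pairing_perfect by (simp add: perfect_pairing_def)

lemma pairing_hom_left: "D \<in> carrier (coh H) \<Longrightarrow> (\<lambda>Z. pairing H Z D) \<in> hom (hom2 H) integer_group"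
  using pairing_bilinear by (simp add: bilinear_pairing_def)

lemma pairing_mult_left:
  "\<lbrakk>Z \<in> carrier (hom2 H); Z' \<in> carrier (hom2 H); D \<in> carrier (coh H)\<rbrakk> \<Longrightarrow>
    pairing H (Z \<otimes>\<^bsub>hom2 H\<^esub> Z') D = pairing H Z D + pairing H Z' D"
  using hom_mult[OF pairing_hom_left] by simp

lemma rat_dual_of_coh:
  assumes "D \<in> carrier (coh H)"
  obtains Z where "Z \<in> carrier (hom2 H)" "rat_dual H Z D 1"
proof -
  have "bb_form H D \<in> hom (coh H) integer_group"
    using bb_bilinear assms by (simp add: bilinear_pairing_def)
  then obtain Z where "Z \<in> carrier (hom2 H)" "\<forall>D'\<in>carrier (coh H). pairing H Z D' = bb_form H D D'"
    using pairing_perfect unfolding perfect_pairing_def by blast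
  with assms show ?thesis
    by (intro that) (auto simp: rat_dual_def)
qed

text \<open>Both sides are q(D, D') / (N N'). This symmetry gives both the well-definedness of
  \<open>q_form\<close> and its commutativity.\<close>

lemma rat_dual_commute:
  assumes "rat_dual H Z D N" "rat_dual H Z' D' N'"
  shows "of_int (pairing H Z D') / of_int N' = (of_int (pairing H Z' D) / of_int N :: rat)"
proof -
  have "N * pairing H Z D' = bb_form H D D'" "N' * pairing H Z' D = bb_form H D' D" "N > 0" "N' > 0"
    using assms by (simp_all add: rat_dual_def)
  moreover have "bb_form H D D' = bb_form H D' D"
    using assms by (simp add: rat_dual_def bb_symmetric)
  ultimately show ?thesis
    by (simp add: field_simps flip: of_int_mult)
qed

text \<open>Only one argument has to be represented by a rational class, so additivity of
  \<open>q_form\<close> reduces to additivity of \<open>pairing\<close>.\<close>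

lemma q_form_rat_dual_right:
  assumes Z: "Z \<in> carrier (hom2 H)" and dual: "rat_dual H Z' D' N'"
  shows "q_form H Z Z' = of_int (pairing H Z D') / of_int N'"
proof -
  obtain D N where DN: "rat_dual H Z D N"
    using rat_dual_exists[OF Z] by blast
  have left: "(of_int (bb_form H E E') / of_int (M * M') :: rat) = of_int (pairing H Z E') / of_int M'"
    if "rat_dual H Z E M" "rat_dual H Z' E' M'" for E E' M M'
    using that by (auto simp: rat_dual_def)
  show ?thesis
    unfolding q_form_def
  proof (rule the_equality)
    show "\<exists>E M E' M'. rat_dual H Z E M \<and> rat_dual H Z' E' M' \<and>
      (of_int (pairing H Z D') / of_int N' :: rat) = of_int (bb_form H E E') / of_int (M * M')"
      using DN dual left by metis
    \<comment> \<open>Two representatives (D', N') and (E', M') of Z' give the same value: for any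
      representative (E, M) of Z, both quotients equal Z' \<cdot> E / M by
      \<open>rat_dual_commute\<close>.\<close>
    show "t = of_int (pairing H Z D') / of_int N'"
      if "\<exists>E M E' M'. rat_dual H Z E M \<and> rat_dual H Z' E' M' \<and>
        t = of_int (bb_form H E E') / of_int (M * M')" for t :: rat
      using that dual left rat_dual_commute by metis
  qed
qed

lemma q_form_commute:
  assumes "Z \<in> carrier (hom2 H)" "Z' \<in> carrier (hom2 H)"
  shows "q_form H Z Z' = q_form H Z' Z"
proof -
  obtain D N D' N' where dual: "rat_dual H Z D N" "rat_dual H Z' D' N'"
    using assms rat_dual_exists by metis
  show ?thesis
    using rat_dual_commute[OF dual] q_form_rat_dual_right[OF assms(1) dual(2)]
      q_form_rat_dual_right[OF assms(2) dual(1)] by simp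
qed

lemma q_form_mult_left:
  assumes "Z \<in> carrier (hom2 H)" "Z' \<in> carrier (hom2 H)" "W \<in> carrier (hom2 H)"
  shows "q_form H (Z \<otimes>\<^bsub>hom2 H\<^esub> Z') W = q_form H Z W + q_form H Z' W"
proof -
  obtain D N where D: "rat_dual H W D N"
    using assms rat_dual_exists by metis
  then have "D \<in> carrier (coh H)" by (simp add: rat_dual_def)
  with D assms show ?thesis
    by (simp add: q_form_rat_dual_right pairing_mult_left add_divide_distrib)
qed

lemma q_form_mult_right:
  assumes "Z \<in> carrier (hom2 H)" "Z' \<in> carrier (hom2 H)" "W \<in> carrier (hom2 H)"
  shows "q_form H W (Z \<otimes>\<^bsub>hom2 H\<^esub> Z') = q_form H W Z + q_form H W Z'"
  using assms by (simp add: q_form_commute[of W] q_form_mult_left)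

lemma q_form_int_pow_left:
  assumes "Z \<in> carrier (hom2 H)" "W \<in> carrier (hom2 H)"
  shows "q_form H (Z [^]\<^bsub>hom2 H\<^esub> (k :: int)) W = of_int k * q_form H Z W"
proof -
  obtain D N where D: "rat_dual H W D N"
    using assms rat_dual_exists by metis
  then have "D \<in> carrier (coh H)" by (simp add: rat_dual_def)
  with D assms show ?thesis
    by (simp add: q_form_rat_dual_right
        hom_integer_group_int_pow[OF hom2.is_group pairing_hom_left])
qed

lemma q_form_int_pow_right:
  assumes "Z \<in> carrier (hom2 H)" "W \<in> carrier (hom2 H)"
  shows "q_form H W (Z [^]\<^bsub>hom2 H\<^esub> (k :: int)) = of_int k * q_form H W Z"
  using assms by (simp add: q_form_commute[of W] q_form_int_pow_left)

section \<open>H^2 as the dual lattice inside H_2\<close>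

lemma hom2_cases:
  assumes "Z \<in> carrier (hom2 H)"
  obtains h and k :: int where "h \<in> carrier (surface_hom H)"
    "Z = incl H h \<otimes>\<^bsub>hom2 H\<^esub> fibre H [^]\<^bsub>hom2 H\<^esub> k"
proof -
  have "Z \<in> (\<lambda>(h, k). incl H h \<otimes>\<^bsub>hom2 H\<^esub> fibre H [^]\<^bsub>hom2 H\<^esub> k) `
      carrier (surface_hom H \<times>\<times> integer_group)"
    using decomposition assms by (simp add: iso_def bij_betw_def)
  then show ?thesis
    by (auto intro: that)
qed

lemma q_form_incl_integral:
  assumes "h \<in> carrier (surface_hom H)" "Z \<in> carrier (hom2 H)"
  shows "q_form H (incl H h) Z \<in> \<int>"
proof -
  obtain h' and k :: int where "h' \<in> carrier (surface_hom H)"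
    "Z = incl H h' \<otimes>\<^bsub>hom2 H\<^esub> fibre H [^]\<^bsub>hom2 H\<^esub> k"
    using hom2_cases[OF assms(2)] .
  with assms show ?thesis
    by (simp add: q_form_mult_right q_form_int_pow_right q_surface q_orthogonal fibre_closed)
qed

lemma q_form_coh_in_hom2_integral:
  assumes "Z \<in> coh_in_hom2 H" "W \<in> carrier (hom2 H)"
  shows "q_form H W Z \<in> \<int>"
proof -
  obtain D where "D \<in> carrier (coh H)" "\<forall>D'\<in>carrier (coh H). pairing H Z D' = bb_form H D D'"
    using assms(1) by (auto simp: coh_in_hom2_def)
  then have "rat_dual H Z D 1"
    by (simp add: rat_dual_def)
  with assms(2) show ?thesis
    by (simp add: q_form_rat_dual_right)
qed

text \<open>Perfectness represents the integral functional q(Z, -) on H_2 by some D in H^2. To see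
  that Z is the image of D, write D' as the dual of some W: then Z \<cdot> D' = q(Z, W) = W \<cdot>
  D = q(D', D).\<close>

lemma coh_in_hom2_if_q_form_integral:
  assumes Z: "Z \<in> carrier (hom2 H)"
    and int: "\<And>W. W \<in> carrier (hom2 H) \<Longrightarrow> q_form H Z W \<in> \<int>"
  shows "Z \<in> coh_in_hom2 H"
proof -
  \<comment> \<open>The floor only changes the type from \<open>rat\<close> to \<open>int\<close>;
    the values are already integers.\<close>
  define \<phi> where "\<phi> W = \<lfloor>q_form H Z W\<rfloor>" for W
  have \<phi>: "of_int (\<phi> W) = q_form H Z W" if "W \<in> carrier (hom2 H)" for W
    using int[OF that] by (auto simp: \<phi>_def elim!: Ints_cases)
  have "of_int (\<phi> (W \<otimes>\<^bsub>hom2 H\<^esub> W')) = (of_int (\<phi> W + \<phi> W') :: rat)"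
    if "W \<in> carrier (hom2 H)" "W' \<in> carrier (hom2 H)" for W W'
    using that Z by (simp add: \<phi> q_form_mult_right)
  then have "\<phi> \<in> hom (hom2 H) integer_group"
    by (intro homI) (simp_all only: of_int_eq_iff, simp_all)
  then obtain D where D: "D \<in> carrier (coh H)" "\<And>W. W \<in> carrier (hom2 H) \<Longrightarrow> pairing H W D = \<phi> W"
    using pairing_perfect unfolding perfect_pairing_def by metis
  have "pairing H Z D' = bb_form H D D'" if D': "D' \<in> carrier (coh H)" for D'
  proof -
    obtain W where W: "W \<in> carrier (hom2 H)" "rat_dual H W D' 1"
      using rat_dual_of_coh[OF D'] .
    have "of_int (pairing H Z D') = q_form H Z W"
      using Z W by (simp add: q_form_rat_dual_right)
    also have "\<dots> = of_int (pairing H W D)"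
      using W D by (simp add: \<phi>)
    also have "pairing H W D = bb_form H D' D"
      using W D by (simp add: rat_dual_def)
    finally show ?thesis
      using D D' by (simp add: bb_symmetric)
  qed
  with Z D show ?thesis
    by (auto simp: coh_in_hom2_def)
qed

lemma coh_in_hom2_iff:
  "Z \<in> coh_in_hom2 H \<longleftrightarrow> Z \<in> carrier (hom2 H) \<and> (\<forall>W\<in>carrier (hom2 H). q_form H Z W \<in> \<int>)"
proof
  assume Z: "Z \<in> coh_in_hom2 H"
  then have "Z \<in> carrier (hom2 H)" by (simp add: coh_in_hom2_def)
  with Z show "Z \<in> carrier (hom2 H) \<and> (\<forall>W\<in>carrier (hom2 H). q_form H Z W \<in> \<int>)"
    by (metis q_form_coh_in_hom2_integral q_form_commute)
qed (simp add: coh_in_hom2_if_q_form_integral)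

lemma incl_in_coh_in_hom2: "h \<in> carrier (surface_hom H) \<Longrightarrow> incl H h \<in> coh_in_hom2 H"
  by (simp add: coh_in_hom2_iff q_form_incl_integral)

lemma q_form_inv_left:
  assumes "Z \<in> carrier (hom2 H)" "W \<in> carrier (hom2 H)"
  shows "q_form H (inv\<^bsub>hom2 H\<^esub> Z) W = - q_form H Z W"
  using q_form_int_pow_left[OF assms, of "-1"] assms
  by (simp add: hom2.int_pow_neg)

lemma subgroup_coh_in_hom2: "subgroup (coh_in_hom2 H) (hom2 H)"
proof (rule hom2.subgroupI)
  have "q_form H \<one>\<^bsub>hom2 H\<^esub> W = 0" if "W \<in> carrier (hom2 H)" for W
    using q_form_int_pow_left[of "\<one>\<^bsub>hom2 H\<^esub>" W 0] that by simp
  then have "\<one>\<^bsub>hom2 H\<^esub> \<in> coh_in_hom2 H"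
    by (simp add: coh_in_hom2_iff)
  then show "coh_in_hom2 H \<noteq> {}" by blast
qed (auto simp: coh_in_hom2_iff q_form_inv_left q_form_mult_left)

section \<open>The discriminant group\<close>

sublocale disc: normal "coh_in_hom2 H" "hom2 H"
  using subgroup_coh_in_hom2 by (rule hom2.subgroup_imp_normal)

lemma disc_class_eq_iff:
  assumes "Z \<in> carrier (hom2 H)" "Z' \<in> carrier (hom2 H)"
  shows "disc_class H Z = disc_class H Z' \<longleftrightarrow> Z \<otimes>\<^bsub>hom2 H\<^esub> inv\<^bsub>hom2 H\<^esub> Z' \<in> coh_in_hom2 H"
proof -
  have "disc_class H Z = disc_class H Z' \<longleftrightarrow> Z \<in> coh_in_hom2 H #>\<^bsub>hom2 H\<^esub> Z'"
    unfolding disc_class_def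
    using hom2.rcos_self[OF assms(1) subgroup_coh_in_hom2]
      hom2.repr_independence[OF _ assms(2) subgroup_coh_in_hom2] by blast
  then show ?thesis
    by (simp add: disc.rcos_module[OF hom2.is_group assms(2,1)])
qed

lemma disc_class_hom: "disc_class H \<in> hom (hom2 H) (disc_group H)"
  using disc.r_coset_hom_Mod unfolding disc_class_def[abs_def] disc_group_def .

lemma group_disc_group: "group (disc_group H)"
  unfolding disc_group_def by (rule disc.factorgroup_is_group)

lemma disc_of_int_eq: "disc_of_int H k = disc_class H (fibre H [^]\<^bsub>hom2 H\<^esub> k)"
  unfolding disc_of_int_def
  using hom_int_pow[OF disc_class_hom fibre_closed hom2.is_group group_disc_group] by simp

lemma inv_disc_of_int: "inv\<^bsub>disc_group H\<^esub> (disc_of_int H k) = disc_of_int H (- k)"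
  unfolding disc_of_int_def
  using group.int_pow_neg[OF group_disc_group hom_in_carrier[OF disc_class_hom fibre_closed]]
  by simp

text \<open>If (k - l) r_n lies in H^2, its product with r_n, namely -(k - l) / (2n - 2), is an
  integer. The bound on \<open>n\<close> keeps the denominator nonzero.\<close>

lemma disc_of_int_eqD:
  assumes "n \<ge> 2" and eq: "disc_of_int H k = disc_of_int H l"
  shows "2 * (int n - 1) dvd k - l"
proof -
  have "fibre H [^]\<^bsub>hom2 H\<^esub> (k - l) \<in> coh_in_hom2 H"
    using eq fibre_closed unfolding disc_of_int_eq
    by (subst hom2.int_pow_diff) (simp_all add: disc_class_eq_iff)
  then have "q_form H (fibre H [^]\<^bsub>hom2 H\<^esub> (k - l)) (fibre H) \<in> \<int>"
    using fibre_closed coh_in_hom2_iff by blast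
  then obtain t where "q_form H (fibre H [^]\<^bsub>hom2 H\<^esub> (k - l)) (fibre H) = of_int t"
    by (rule Ints_cases)
  then have "of_int (k - l) * (- 1 / (2 * of_nat n - 2)) = (of_int t :: rat)"
    unfolding q_form_int_pow_left[OF fibre_closed fibre_closed] q_fibre .
  moreover have "2 * of_nat n - 2 \<noteq> (0 :: rat)"
    using assms(1) by simp
  ultimately have "of_int (k - l) = (of_int (- t * (2 * (int n - 1))) :: rat)"
    by (simp add: field_simps)
  then have "k - l = - t * (2 * (int n - 1))"
    by (simp only: of_int_eq_iff)
  then show ?thesis by (metis dvd_triv_right)
qed

text \<open>The surface part lies in H^2 and so vanishes in the quotient.\<close>

lemma disc_class_incl_mult_fibre:
  assumes "h \<in> carrier (surface_hom H)"
  shows "disc_class H (incl H h \<otimes>\<^bsub>hom2 H\<^esub> fibre H [^]\<^bsub>hom2 H\<^esub> (k :: int)) = disc_of_int H k"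
  using assms fibre_closed
  by (simp add: disc_of_int_eq disc_class_eq_iff hom2.m_assoc incl_in_coh_in_hom2)

lemma q_form_incl_mult_fibre:
  fixes k :: int
  assumes "h \<in> carrier (surface_hom H)" and "Z = incl H h \<otimes>\<^bsub>hom2 H\<^esub> fibre H [^]\<^bsub>hom2 H\<^esub> k"
  shows "q_form H Z Z = of_int (surface_form H h h) - (of_int k)\<^sup>2 / (2 * of_nat n - 2)"
  using assms fibre_closed
  by (simp add: q_form_mult_left q_form_mult_right q_form_int_pow_left q_form_int_pow_right
      q_surface q_orthogonal q_fibre q_form_commute[of "fibre H" "incl H h"] power2_eq_square)

end

theorem proposition5p2:
  fixes n g :: nat and p :: int
    and H :: "('a, 'b, 'c) hilb_data" and h\<^sub>S :: 'a and \<beta> :: 'c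
  assumes "n > 0" and "g > 0" and "2 * g \<le> n"
    and "hilb_K3 n H"
    and "h\<^sub>S \<in> carrier (surface_hom H)"
    and "surface_form H h\<^sub>S h\<^sub>S = 2 * p - 2"
    and "\<beta> = incl H h\<^sub>S \<otimes>\<^bsub>hom2 H\<^esub> fibre H [^]\<^bsub>hom2 H\<^esub> (- (2 * int g))"
  shows "p \<ge> int g \<longleftrightarrow>
    (\<exists>d r :: nat \<Rightarrow> int.
        q_form H \<beta> \<beta> = - 2 + (\<Sum>i=1..n-1. 2 * of_int (d i))
          - 1 / (2 * of_nat n - 2) * (of_int (\<Sum>i=1..n-1. r i))\<^sup>2 \<and>
        (disc_class H \<beta> = disc_of_int H (\<Sum>i=1..n-1. r i) \<or>
         disc_class H \<beta> = inv\<^bsub>disc_group H\<^esub> (disc_of_int H (\<Sum>i=1..n-1. r i))) \<and>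
        (\<forall>i\<in>{1..n-1}. 4 * d i - (r i)\<^sup>2 \<ge> 0))"
    (is "_ \<longleftrightarrow> (\<exists>d r. ?q d r \<and> ?disc r \<and> ?bound d r)")
proof -
  interpret hilb_K3 n H by fact
  define m where "m = n - 1"
  \<comment> \<open>From g \<ge> 1 and 2g \<le> n follow n \<ge> 2 and g \<le> n - g \<le> n - 1. So
    2n - 2 = 2m is nonzero and g of the m indices can be chosen.\<close>
  have m: "m > 0" "g \<le> m" "n = Suc m"
    using assms(2,3) by (auto simp: m_def)
  \<comment> \<open>The two terms -2 cancel, and multiplying by 2m turns the rational equation into
    an integer one.\<close>
  have q_iff: "?q d r \<longleftrightarrow> 4 * int m * (p - (\<Sum>i=1..m. d i)) = 4 * (int g)\<^sup>2 - (\<Sum>i=1..m. r i)\<^sup>2"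
    for d r
  proof -
    have "?q d r \<longleftrightarrow> (of_int (2 * p - 2) - (2 * of_nat g)\<^sup>2 / (2 * of_nat m) :: rat)
        = - 2 + 2 * of_int (\<Sum>i=1..m. d i) - (of_int (\<Sum>i=1..m. r i))\<^sup>2 / (2 * of_nat m)"
      using q_form_incl_mult_fibre[OF assms(5,7)] assms(6) m(3)
      by (simp add: sum_distrib_left)
    also have "\<dots> \<longleftrightarrow> (of_int (4 * int m * (p - (\<Sum>i=1..m. d i))) :: rat)
        = of_int (4 * (int g)\<^sup>2 - (\<Sum>i=1..m. r i)\<^sup>2)"
    proof -
      have "2 * P - 2 - X / (2 * M) = - 2 + 2 * D - Y / (2 * M) \<longleftrightarrow> 4 * M * (P - D) = X - Y"
        if "M > 0" for P D X Y M :: rat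
        using that by (auto simp: field_simps)
      from this[of "of_nat m" "of_int p" "(2 * of_nat g)\<^sup>2"] m(1) show ?thesis
        by (simp add: power_mult_distrib)
    qed
    finally show ?thesis
      by (simp only: of_int_eq_iff)
  qed
  have disc_iff: "?disc r \<longleftrightarrow> disc_of_int H (- (2 * int g)) = disc_of_int H (\<Sum>i=1..m. r i) \<or>
      disc_of_int H (- (2 * int g)) = disc_of_int H (- (\<Sum>i=1..m. r i))" for r
    using disc_class_incl_mult_fibre[OF assms(5)] by (simp add: assms(7) inv_disc_of_int m_def)
  show ?thesis
  proof
    assume "int g \<le> p"
    then obtain d r :: "nat \<Rightarrow> int" where "(\<Sum>i=1..m. d i) = p" "(\<Sum>i=1..m. r i) = 2 * int g"
      "\<And>i. i \<in> {1..m} \<Longrightarrow> (r i)\<^sup>2 \<le> 4 * d i"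
      using ex_square_bounds assms(2) m(2) by metis
    \<comment> \<open>The sum of the \<open>r i\<close> is 2g while the class of
      \<open>\<beta>\<close> is [-2g], so the minus sign is the one that applies. In
      \<open>?q\<close> both sides of the integer form are 0.\<close>
    then have "?q d r" "?disc r" "?bound d r"
      unfolding q_iff disc_iff by (simp_all add: m_def)
    then show "\<exists>d r. ?q d r \<and> ?disc r \<and> ?bound d r" by blast
  next
    assume "\<exists>d r. ?q d r \<and> ?disc r \<and> ?bound d r"
    then obtain d r where dr: "?q d r" "?disc r" "?bound d r" by blast
    have "2 * int m dvd - (2 * int g) - (\<Sum>i=1..m. r i) \<or>
        2 * int m dvd - (2 * int g) + (\<Sum>i=1..m. r i)"
      using dr(2) m unfolding disc_iff
      by (auto dest!: disc_of_int_eqD[rotated])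
    \<comment> \<open>Modulo 2m the sum is -2g for the plus sign and 2g for the minus sign. Both
      residues have absolute value 2g, which is all that \<open>le_if_square_bounds\<close> asks of
      \<open>u\<close>.\<close>
    then obtain t where "(\<Sum>i=1..m. r i) = - (2 * int g) + 2 * int m * t \<or>
        (\<Sum>i=1..m. r i) = 2 * int g + 2 * int m * t"
    proof (elim disjE dvdE)
      fix k
      assume "- (2 * int g) - (\<Sum>i=1..m. r i) = 2 * int m * k"
      then show ?thesis by (intro that[of "- k"]) (simp add: algebra_simps)
    next
      fix k
      assume "- (2 * int g) + (\<Sum>i=1..m. r i) = 2 * int m * k"
      then show ?thesis by (intro that[of k]) (simp add: algebra_simps)
    qed
    then obtain u where "\<bar>u\<bar> = 2 * int g" "(\<Sum>i=1..m. r i) = u + 2 * int m * t"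
      by (metis abs_minus_cancel abs_of_nat abs_mult abs_numeral)
    moreover have "(r i)\<^sup>2 \<le> 4 * d i" if "i \<in> {1..m}" for i
      using dr(3) that by (auto simp: m_def)
    ultimately show "int g \<le> p"
      using m(1) dr(1) le_if_square_bounds[of "{1..m}" r d u "int g" t p] unfolding q_iff
      by simp
  qed
qed

end
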